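(* Let $\Omega\subset\mathbb{R}^n$ be a bounded domain, let $u,v\in\mathrm{Lip}_0(\Omega)\setminus\{0\}$ be non-negative minimizers of $R^\infty$ and assume that $\omega_{\max}(v)=\mathcal{R}_\Omega$. Let $\nu,\tau\in\mathcal{M}_+(\Omega)$ satisfy the optimality condition $\lambda_\infty\nu u=-\operatorname{div}(\tau\nabla_\tau u)$ together with: $\nu(\Omega)=1/\|u\|_\infty$, $\tau(\Omega)=1/\|\nabla u\|_{L^\infty}$, $\nu(\Omega\setminus\omega_{\max}(u))=0$, $\tau(\Omega\setminus\Omega_{\max}(u))=0$, and $\langle\!\langle\nabla u,\sigma\rangle\!\rangle=\|\nabla u\|_{L^\infty}|\sigma|$ for $\sigma:=\tau\nabla_\tau u$. Then $$\nabla_\tau u\cdot\nabla_\tau v=|\nabla_\tau u|\,|\nabla_\tau v|\quad\tau\text{-a.e. in }\Omega.$$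
   Context: $\mathrm{Lip}_0(\Omega)$: Lipschitz functions on $\overline\Omega$ vanishing on $\partial\Omega$. $R^\infty(u)=\|\nabla u\|_{L^\infty}/\|u\|_\infty$; $\lambda_\infty=\inf R^\infty=1/r_\Omega$, $r_\Omega=\max_{x\in\Omega}\operatorname{dist}(x,\partial\Omega)$. High ridge: $\mathcal{R}_\Omega=\arg\max_{x\in\Omega}\operatorname{dist}(x,\partial\Omega)$. $\omega_{\max}(u)=\{x\in\Omega:|u(x)|=\|u\|_\infty\}$. $\mathcal{M}(\Omega)$: finite signed Radon measures on $\Omega$; $\mathcal{M}_+(\Omega)$: the non-negative ones. $\sigma\in\mathcal{M}(\Omega,\mathbb{R}^n)$ is a divergence-measure field, $\sigma\in\mathcal{DM}(\Omega,\mathbb{R}^n)$, with $\operatorname{div}\sigma:=\mu\in\mathcal{M}(\Omega)$, if $-\int_\Omega\nabla\varphi\cdot d\sigma=\int_\Omega\varphi\,d\mu$ for all $\varphi\in C_c^\infty(\Omega)$. For $u\in\mathrm{Lip}_0(\Omega)$ consider sequences $\{u_k\}\subset C_c^\infty(\Omega)$ with ( * ) $\sup_k\max_\Omega|\nabla u_k|\le\|\nabla u\|_{L^\infty}$ and $\max_\Omega|u_k-u|\to0$. Then $\Omega_{\max}(u)=\{x\in\Omega:\limsup_k|\nabla u_k(x)|=\|\nabla u\|_{L^\infty}\}$ for any sequence satisfying ( * ) (read for an arbitrary choice of such a sequence). Tangential gradient: for $\mu\in\mathcal{M}_+(\Omega)$, let $N_\mu$ be the set of $\xi\in L^\infty_\mu(\Omega,\mathbb{R}^n)$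 for which there is $\{v_k\}\subset C_c^\infty(\Omega)$ with $v_k\to0$ uniformly and $\nabla v_k\rightharpoonup^*\xi$ in $L^\infty_\mu$. The tangent space of $\mu$ is the ($\mu$-a.e. unique) $\mu$-measurable field of linear subspaces $T_\mu(x)\subset\mathbb{R}^n$ such that $\theta\in L^1_\mu(\Omega,\mathbb{R}^n)$ satisfies $\int\theta\cdot\xi\,d\mu=0$ for all $\xi\in N_\mu$ iff $\theta(x)\in T_\mu(x)$ for $\mu$-a.e. $x$. $P_\mu(x,\cdot)$ is the orthogonal projection onto $T_\mu(x)$; $\nabla_\mu u$ is the weak$^*$ limit in $L^\infty_\mu$ of $P_\mu(\cdot,\nabla u_k(\cdot))$ for any sequence satisfying ( * ) (it exists and is independent of the sequence). Pairing: for $u\in\mathrm{Lip}_0(\Omega)$, $\sigma\in\mathcal{DM}(\Omega,\mathbb{R}^n)$, $\langle\!\langle\nabla u,\sigma\rangle\!\rangle\in\mathcal{M}(\Omega)$ is the signed measure with $\int\varphi\,d\langle\!\langle\nabla u,\sigma\rangle\!\rangle=-\int u\varphi\,d\operatorname{div}\sigma-\int u\nabla\varphi\cdot d\sigma$ for all $\varphi\in C_c^\infty(\Omega)$. *)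

theory Defs
  imports "HOL-Analysis.Analysis" "HOL-Probability.Essential_Supremum"
begin

section \<open>Test functions and gradients\<close>

definition domain_on :: "'a::euclidean_space set \<Rightarrow> bool" where
  "domain_on \<Omega> \<longleftrightarrow> open \<Omega> \<and> connected \<Omega> \<and> \<Omega> \<noteq> {}"

primrec Ck :: "nat \<Rightarrow> ('a::euclidean_space \<Rightarrow> real) \<Rightarrow> bool" where
  "Ck 0 f \<longleftrightarrow> continuous_on UNIV f"
| "Ck (Suc k) f \<longleftrightarrow> (\<forall>x. f differentiable (at x)) \<and>
     (\<forall>b\<in>Basis. Ck k (\<lambda>x. frechet_derivative f (at x) b))"

text \<open>The space of smooth functions with compact support in \<open>\<Omega>\<close>; its elements are
  extended by zero to the whole space.\<close>

definition Cc_infty :: "'a::euclidean_space set \<Rightarrow> ('a \<Rightarrow> real) set" where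
  "Cc_infty \<Omega> = {\<phi>. (\<forall>k. Ck k \<phi>) \<and> compact (closure {x. \<phi> x \<noteq> 0}) \<and>
                     closure {x. \<phi> x \<noteq> 0} \<subseteq> \<Omega>}"

text \<open>For Lipschitz functions the points of non-differentiability form a Lebesgue null set
  (Rademacher), so the value chosen there does not affect the essential supremum.\<close>

definition grad :: "('a::euclidean_space \<Rightarrow> real) \<Rightarrow> 'a \<Rightarrow> 'a" where
  "grad f x = (if f differentiable (at x)
               then \<Sum>b\<in>Basis. frechet_derivative f (at x) b *\<^sub>R b else 0)"

section \<open>Lipschitz functions and the Rayleigh quotient\<close>

definition Lip0 :: "'a::euclidean_space set \<Rightarrow> ('a \<Rightarrow> real) set" where
  "Lip0 \<Omega> = {u. (\<exists>L. L-lipschitz_on (closure \<Omega>) u) \<and> (\<forall>x\<in>frontier \<Omega>. u x = 0)}"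

text \<open>\<open>Lip0 \<Omega>\<close> without the zero function; only values on the closure of \<open>\<Omega>\<close> count.\<close>

definition Lip0_nonzero :: "'a::euclidean_space set \<Rightarrow> ('a \<Rightarrow> real) set" where
  "Lip0_nonzero \<Omega> = {u \<in> Lip0 \<Omega>. \<exists>x\<in>closure \<Omega>. u x \<noteq> 0}"

definition sup_norm :: "'a::euclidean_space set \<Rightarrow> ('a \<Rightarrow> real) \<Rightarrow> real" where
  "sup_norm \<Omega> u = (SUP x\<in>\<Omega>. \<bar>u x\<bar>)"

definition grad_norm :: "'a::euclidean_space set \<Rightarrow> ('a \<Rightarrow> real) \<Rightarrow> real" where
  "grad_norm \<Omega> u = real_of_ereal (esssup (lebesgue_on \<Omega>) (\<lambda>x. ereal (norm (grad u x))))"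

definition rayleigh_infty :: "'a::euclidean_space set \<Rightarrow> ('a \<Rightarrow> real) \<Rightarrow> real" where
  "rayleigh_infty \<Omega> u = grad_norm \<Omega> u / sup_norm \<Omega> u"

definition lambda_infty :: "'a::euclidean_space set \<Rightarrow> real" where
  "lambda_infty \<Omega> = (INF u\<in>Lip0_nonzero \<Omega>. rayleigh_infty \<Omega> u)"

definition minimizer_infty :: "'a::euclidean_space set \<Rightarrow> ('a \<Rightarrow> real) \<Rightarrow> bool" where
  "minimizer_infty \<Omega> u \<longleftrightarrow> is_arg_min (rayleigh_infty \<Omega>) (\<lambda>w. w \<in> Lip0_nonzero \<Omega>) u"

definition high_ridge :: "'a::euclidean_space set \<Rightarrow> 'a set" where
  "high_ridge \<Omega> = {x. is_arg_max (\<lambda>y. infdist y (frontier \<Omega>)) (\<lambda>y. y \<in> \<Omega>) x}"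

definition omega_max :: "'a::euclidean_space set \<Rightarrow> ('a \<Rightarrow> real) \<Rightarrow> 'a set" where
  "omega_max \<Omega> u = {x\<in>\<Omega>. \<bar>u x\<bar> = sup_norm \<Omega> u}"

definition admissible_seq ::
    "'a::euclidean_space set \<Rightarrow> ('a \<Rightarrow> real) \<Rightarrow> (nat \<Rightarrow> 'a \<Rightarrow> real) \<Rightarrow> bool" where
  "admissible_seq \<Omega> u us \<longleftrightarrow> (\<forall>k. us k \<in> Cc_infty \<Omega>) \<and>
     (\<forall>k. \<forall>x\<in>\<Omega>. norm (grad (us k) x) \<le> grad_norm \<Omega> u) \<and>
     uniform_limit \<Omega> us u sequentially"

definition Omega_max ::
    "'a::euclidean_space set \<Rightarrow> ('a \<Rightarrow> real) \<Rightarrow> (nat \<Rightarrow> 'a \<Rightarrow> real) \<Rightarrow> 'a set" where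
  "Omega_max \<Omega> u us =
     {x\<in>\<Omega>. limsup (\<lambda>k. ereal (norm (grad (us k) x))) = ereal (grad_norm \<Omega> u)}"

section \<open>Finite Radon measures\<close>

text \<open>A finite Borel measure on an open subset of a Euclidean space is automatically Radon.
  Signed and vector-valued measures are countably additive set functions on the Borel subsets
  of \<open>\<Omega>\<close>; having values in a finite-dimensional space, they have finite total variation.\<close>

abbreviation borel_sets_on :: "'a::euclidean_space set \<Rightarrow> 'a set set" where
  "borel_sets_on \<Omega> \<equiv> sets (restrict_space borel \<Omega>)"

definition pos_measures :: "'a::euclidean_space set \<Rightarrow> 'a measure set" where
  "pos_measures \<Omega> = {\<mu>. finite_measure \<mu> \<and> sets \<mu> = borel_sets_on \<Omega>}"

definition vec_measures ::
    "'a::euclidean_space set \<Rightarrow> ('a set \<Rightarrow> 'b::euclidean_space) set" where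
  "vec_measures \<Omega> = {\<sigma>. \<forall>A. range A \<subseteq> borel_sets_on \<Omega> \<longrightarrow> disjoint_family A \<longrightarrow>
                           (\<lambda>i::nat. \<sigma> (A i)) sums \<sigma> (\<Union>i. A i)}"

definition total_variation ::
    "'a::euclidean_space set \<Rightarrow> ('a set \<Rightarrow> 'b::euclidean_space) \<Rightarrow> 'a set \<Rightarrow> real" where
  "total_variation \<Omega> \<sigma> A =
     (SUP P\<in>{P. finite P \<and> partition_on A P \<and> P \<subseteq> borel_sets_on \<Omega>}. \<Sum>B\<in>P. norm (\<sigma> B))"

text \<open>The positive part in the Jordan decomposition of a signed measure. The coercion
  \<open>ennreal\<close> truncates negative values to zero, which is harmless as \<open>B = {}\<close> competes.\<close>

definition jordan_pos ::
    "'a::euclidean_space set \<Rightarrow> ('a set \<Rightarrow> real) \<Rightarrow> 'a measure" where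
  "jordan_pos \<Omega> m = measure_of \<Omega> (borel_sets_on \<Omega>)
     (\<lambda>A. SUP B\<in>{B \<in> borel_sets_on \<Omega>. B \<subseteq> A}. ennreal (m B))"

definition signed_integral ::
    "'a::euclidean_space set \<Rightarrow> ('a set \<Rightarrow> real) \<Rightarrow> ('a \<Rightarrow> real) \<Rightarrow> real" where
  "signed_integral \<Omega> m f =
     (\<integral>x. f x \<partial>jordan_pos \<Omega> m) - (\<integral>x. f x \<partial>jordan_pos \<Omega> (\<lambda>A. - m A))"

text \<open>The integral of the inner product of the vector field \<open>F\<close> with the vector measure
  \<open>\<sigma>\<close>, computed componentwise.\<close>

definition vec_integral ::
    "'a::euclidean_space set \<Rightarrow> ('a set \<Rightarrow> 'b::euclidean_space) \<Rightarrow> ('a \<Rightarrow> 'b) \<Rightarrow> real" where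
  "vec_integral \<Omega> \<sigma> F =
     (\<Sum>b\<in>Basis. signed_integral \<Omega> (\<lambda>A. \<sigma> A \<bullet> b) (\<lambda>x. F x \<bullet> b))"

text \<open>The measure with density \<open>f\<close> with respect to \<open>\<mu>\<close>.\<close>

definition weighted ::
    "'a measure \<Rightarrow> ('a \<Rightarrow> 'b::euclidean_space) \<Rightarrow> 'a set \<Rightarrow> 'b" where
  "weighted \<mu> f A = (LINT x:A|\<mu>. f x)"

text \<open>\<open>has_divergence \<Omega> \<sigma> \<mu>\<close>: \<open>\<sigma>\<close> is a divergence-measure field whose
  divergence is the (uniquely determined) signed measure \<open>\<mu>\<close>.\<close>

definition has_divergence ::
    "'a::euclidean_space set \<Rightarrow> ('a set \<Rightarrow> 'a) \<Rightarrow> ('a set \<Rightarrow> real) \<Rightarrow> bool" where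
  "has_divergence \<Omega> \<sigma> \<mu> \<longleftrightarrow> \<sigma> \<in> vec_measures \<Omega> \<and> \<mu> \<in> vec_measures \<Omega> \<and>
     (\<forall>\<phi>\<in>Cc_infty \<Omega>. - vec_integral \<Omega> \<sigma> (grad \<phi>) = signed_integral \<Omega> \<mu> \<phi>)"

text \<open>\<open>has_pairing \<Omega> u \<sigma> \<rho>\<close>: the pairing of the gradient of \<open>u\<close> with the
  divergence-measure field \<open>\<sigma>\<close> is the (uniquely determined) signed measure \<open>\<rho>\<close>.\<close>

definition has_pairing ::
    "'a::euclidean_space set \<Rightarrow> ('a \<Rightarrow> real) \<Rightarrow> ('a set \<Rightarrow> 'a) \<Rightarrow> ('a set \<Rightarrow> real) \<Rightarrow> bool" where
  "has_pairing \<Omega> u \<sigma> \<rho> \<longleftrightarrow> \<rho> \<in> vec_measures \<Omega> \<and>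
     (\<exists>\<mu>. has_divergence \<Omega> \<sigma> \<mu> \<and>
       (\<forall>\<phi>\<in>Cc_infty \<Omega>. signed_integral \<Omega> \<rho> \<phi> =
          - signed_integral \<Omega> \<mu> (\<lambda>x. u x * \<phi> x)
          - vec_integral \<Omega> \<sigma> (\<lambda>x. u x *\<^sub>R grad \<phi> x)))"

section \<open>Tangent spaces of measures and tangential gradients\<close>

definition Linf :: "'a measure \<Rightarrow> ('a \<Rightarrow> 'b::euclidean_space) set" where
  "Linf \<mu> = {f \<in> borel_measurable \<mu>. \<exists>c. AE x in \<mu>. norm (f x) \<le> c}"

text \<open>Sequential weak* convergence in the essentially bounded fields, as the dual of the
  integrable ones.\<close>

definition weak_star_limit ::
    "'a measure \<Rightarrow> (nat \<Rightarrow> 'a \<Rightarrow> 'b::euclidean_space) \<Rightarrow> ('a \<Rightarrow> 'b) \<Rightarrow> bool" where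
  "weak_star_limit \<mu> fs f \<longleftrightarrow> (\<forall>k. fs k \<in> Linf \<mu>) \<and> f \<in> Linf \<mu> \<and>
     (\<forall>\<theta>. integrable \<mu> \<theta> \<longrightarrow>
        (\<lambda>k. \<integral>x. \<theta> x \<bullet> fs k x \<partial>\<mu>) \<longlonglongrightarrow> (\<integral>x. \<theta> x \<bullet> f x \<partial>\<mu>))"

definition N_space :: "'a::euclidean_space set \<Rightarrow> 'a measure \<Rightarrow> ('a \<Rightarrow> 'a) set" where
  "N_space \<Omega> \<mu> = {\<xi> \<in> Linf \<mu>. \<exists>vs. (\<forall>k. vs k \<in> Cc_infty \<Omega>) \<and>
     uniform_limit \<Omega> vs (\<lambda>_. 0) sequentially \<and> weak_star_limit \<mu> (\<lambda>k. grad (vs k)) \<xi>}"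

definition orth_proj :: "'a::euclidean_space set \<Rightarrow> 'a \<Rightarrow> 'a" where
  "orth_proj S c = (THE y. y \<in> S \<and> (\<forall>z\<in>S. orthogonal (c - y) z))"

text \<open>A field of subspaces is measurable when its orthogonal projections are. The tangent
  space is determined only almost everywhere, hence a predicate.\<close>

definition tangent_space ::
    "'a::euclidean_space set \<Rightarrow> 'a measure \<Rightarrow> ('a \<Rightarrow> 'a set) \<Rightarrow> bool" where
  "tangent_space \<Omega> \<mu> T \<longleftrightarrow> (\<forall>x\<in>\<Omega>. subspace (T x)) \<and>
     (\<forall>c. (\<lambda>x. orth_proj (T x) c) \<in> borel_measurable \<mu>) \<and>
     (\<forall>\<theta>. integrable \<mu> \<theta> \<longrightarrow>
        ((\<forall>\<xi>\<in>N_space \<Omega> \<mu>. (\<integral>x. \<theta> x \<bullet> \<xi> x \<partial>\<mu>) = 0) \<longleftrightarrow> (AE x in \<mu>. \<theta> x \<in> T x)))"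

text \<open>\<open>g\<close> represents the tangential gradient of \<open>u\<close> with respect to \<open>\<mu>\<close>, where
  \<open>T\<close> is the tangent space of \<open>\<mu>\<close>. Admissible sequences always exist; the first conjunct
  keeps the second from being read as vacuous.\<close>

definition tangential_gradient ::
    "'a::euclidean_space set \<Rightarrow> 'a measure \<Rightarrow> ('a \<Rightarrow> 'a set) \<Rightarrow> ('a \<Rightarrow> real) \<Rightarrow> ('a \<Rightarrow> 'a) \<Rightarrow> bool"
  where
  "tangential_gradient \<Omega> \<mu> T u g \<longleftrightarrow> (\<exists>us. admissible_seq \<Omega> u us) \<and>
     (\<forall>us. admissible_seq \<Omega> u us \<longrightarrow>
        weak_star_limit \<mu> (\<lambda>k x. orth_proj (T x) (grad (us k) x)) g)"

end

theory Submission
  imports Defs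
begin

text \<open>
  The idea is to test the optimality condition with \<open>v\<close> in place of \<open>u\<close>. Write
  \<open>L\<close> and \<open>M\<close> for the gradient norm and the sup norm, so that
  \<open>\<lambda> = L u / M u = L v / M v\<close>. For the tangential
  gradients \<open>gu\<close> and \<open>gv\<close>, integration by parts suggests
  \<open>\<integral> gu \<bullet> gv d\<tau> = \<lambda> \<integral> u v d\<nu>\<close>, and \<open>\<nu>\<close> lives on the points where \<open>u\<close> is
  maximal. Every function in \<open>Lip0\<close> is dominated by \<open>L\<close> times the distance to the boundary,
  and comparison of a minimizer with the distance function shows that such points lie on the
  high ridge (\<open>omega_max_subset_high_ridge\<close>), where \<open>v\<close> is maximal by hypothesis. The right-hand side
  is therefore \<open>\<lambda> * M u * M v * \<nu>(\<Omega>) = L v\<close>. On the other hand tangential gradients obey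
  \<open>\<bar>gu\<bar> \<le> L u\<close> and \<open>\<bar>gv\<bar> \<le> L v\<close>, so the left-hand side is at most
  \<open>L u * L v * \<tau>(\<Omega>) = L v\<close>. Equality in this estimate forces \<open>gu \<bullet> gv = L u * L v\<close> almost
  everywhere, and by Cauchy-Schwarz this is the claim.

  Since \<open>v\<close> is no test function, the first identity is proved by a limit along an admissible
  sequence \<open>v\<^sub>k\<close>. The divergence condition controls \<open>\<integral> gu \<bullet> \<nabla>v\<^sub>k d\<tau>\<close>, whereas only the
  projections of \<open>\<nabla>v\<^sub>k\<close> onto the tangent space converge; the two agree because the tangential
  gradient of \<open>u\<close> is itself a tangent field (\<open>tangential_gradient_tangent\<close>).
\<close>

section \<open>Gradients, test functions and the distance to the boundary\<close>

lemma frechet_derivative_eq_grad_inner: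
  assumes "f differentiable (at x)"
  shows "frechet_derivative f (at x) h = grad f x \<bullet> h"
proof -
  let ?D = "frechet_derivative f (at x)"
  have lin: "linear ?D"
    using assms linear_frechet_derivative by blast
  have "?D h = ?D (\<Sum>b\<in>Basis. (h \<bullet> b) *\<^sub>R b)"
    by (simp add: euclidean_representation)
  also have "\<dots> = (\<Sum>b\<in>Basis. (h \<bullet> b) * ?D b)"
    using lin by (simp add: linear_sum linear_cmul)
  also have "\<dots> = grad f x \<bullet> h"
    using assms by (simp add: grad_def inner_sum_left inner_commute[of h] mult.commute)
  finally show ?thesis .
qed

lemma has_derivative_grad:
  assumes "f differentiable (at x)"
  shows "(f has_derivative (\<lambda>h. grad f x \<bullet> h)) (at x)"
proof -
  have "frechet_derivative f (at x) = (\<lambda>h. grad f x \<bullet> h)"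
    using frechet_derivative_eq_grad_inner[OF assms] by auto
  then show ?thesis
    using assms frechet_derivative_works by metis
qed

lemma norm_grad_le_lipschitz:
  fixes f :: "'a::euclidean_space \<Rightarrow> real"
  assumes "L-lipschitz_on UNIV f"
  shows "norm (grad f x) \<le> L"
proof (cases "f differentiable (at x)")
  case False
  then show ?thesis
    using lipschitz_on_nonneg[OF assms] by (simp add: grad_def)
next
  case True
  let ?g = "grad f x"
  have line: "((\<lambda>t::real. x + t *\<^sub>R ?g) has_derivative (\<lambda>t. t *\<^sub>R ?g)) (at 0)"
    by (auto intro!: derivative_eq_intros)
  have "(f has_derivative (\<lambda>h. ?g \<bullet> h)) (at (x + 0 *\<^sub>R ?g))"
    using has_derivative_grad[OF True] by simp
  from has_derivative_compose[OF line this]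
  have "((\<lambda>t. f (x + t *\<^sub>R ?g)) has_real_derivative (?g \<bullet> ?g)) (at 0)"
    by (rule has_derivative_imp_has_field_derivative) simp
  then have lim: "((\<lambda>t. (f (x + t *\<^sub>R ?g) - f x) / t) \<longlongrightarrow> ?g \<bullet> ?g) (at 0)"
    by (simp add: DERIV_def)
  have "(f (x + t *\<^sub>R ?g) - f x) / t \<le> L * norm ?g" for t
  proof (cases "t = 0")
    case True
    then show ?thesis using lipschitz_on_nonneg[OF assms] by simp
  next
    case False
    have "(f (x + t *\<^sub>R ?g) - f x) / t \<le> \<bar>f (x + t *\<^sub>R ?g) - f x\<bar> / \<bar>t\<bar>"
      by (metis abs_divide abs_ge_self)
    also have "\<dots> \<le> (L * (\<bar>t\<bar> * norm ?g)) / \<bar>t\<bar>"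
      using lipschitz_onD[OF assms, of "x + t *\<^sub>R ?g" x]
      by (intro divide_right_mono) (auto simp: dist_norm)
    finally show ?thesis using False by simp
  qed
  then have "?g \<bullet> ?g \<le> L * norm ?g"
    by (intro tendsto_upperbound[OF lim]) auto
  then show ?thesis
    by (cases "?g = 0")
      (use lipschitz_on_nonneg[OF assms] in \<open>auto simp: power2_norm_eq_inner[symmetric] power2_eq_square\<close>)
qed

lemma Cc_infty_differentiable: "\<phi> \<in> Cc_infty \<Omega> \<Longrightarrow> \<phi> differentiable (at x)"
  unfolding Cc_infty_def by (auto dest: spec[of _ "Suc 0"])

lemma Cc_infty_continuous: "\<phi> \<in> Cc_infty \<Omega> \<Longrightarrow> continuous_on UNIV \<phi>"
  unfolding Cc_infty_def by (auto dest: spec[of _ 0])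

lemma Cc_infty_grad_continuous:
  fixes \<phi> :: "'a::euclidean_space \<Rightarrow> real"
  assumes "\<phi> \<in> Cc_infty \<Omega>"
  shows "continuous_on UNIV (grad \<phi>)"
proof -
  have "Ck (Suc 0) \<phi>"
    using assms unfolding Cc_infty_def by blast
  then have "continuous_on UNIV (\<lambda>x. frechet_derivative \<phi> (at x) b)" if "b \<in> Basis" for b
    using that by simp
  moreover have "grad \<phi> = (\<lambda>x. \<Sum>b\<in>Basis. frechet_derivative \<phi> (at x) b *\<^sub>R b)"
    using Cc_infty_differentiable[OF assms] by (auto simp: grad_def)
  ultimately show ?thesis
    by (auto intro!: continuous_intros)
qed

lemma Cc_infty_zero_outside: "\<phi> \<in> Cc_infty \<Omega> \<Longrightarrow> x \<notin> \<Omega> \<Longrightarrow> \<phi> x = 0"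
  unfolding Cc_infty_def using closure_subset[of "{x. \<phi> x \<noteq> 0}"] by auto

lemma Cc_infty_grad_zero_outside:
  fixes \<phi> :: "'a::euclidean_space \<Rightarrow> real"
  assumes "\<phi> \<in> Cc_infty \<Omega>" "x \<notin> \<Omega>"
  shows "grad \<phi> x = 0"
proof -
  let ?C = "closure {x. \<phi> x \<noteq> 0}"
  have "x \<in> - ?C"
    using assms by (auto simp: Cc_infty_def)
  moreover have "0 = \<phi> y" if "y \<in> - ?C" for y
    using that closure_subset[of "{x. \<phi> x \<noteq> 0}"] by auto
  moreover have "open (- ?C)" by (simp add: open_Compl)
  ultimately have "(\<phi> has_derivative (\<lambda>h. 0)) (at x)"
    using has_derivative_transform_within_open[OF has_derivative_const[of 0]] by metis
  then have "frechet_derivative \<phi> (at x) = (\<lambda>h. 0)"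
    using frechet_derivative_at by metis
  then show ?thesis
    by (simp add: grad_def)
qed

text \<open>A test function vanishes outside \<open>\<Omega>\<close>, so the gradient bound holds on the whole space and
  the mean value inequality applies along a segment from \<open>x\<close> to a nearest boundary
  point, wherever that segment runs.\<close>

lemma Cc_infty_le_infdist:
  fixes \<phi> :: "'a::euclidean_space \<Rightarrow> real"
  assumes \<phi>: "\<phi> \<in> Cc_infty \<Omega>" and L: "0 \<le> L" "\<And>x. x \<in> \<Omega> \<Longrightarrow> norm (grad \<phi> x) \<le> L"
    and \<Omega>: "open \<Omega>" "frontier \<Omega> \<noteq> {}"
  shows "\<bar>\<phi> x\<bar> \<le> L * infdist x (frontier \<Omega>)"
proof -
  obtain y where y: "y \<in> frontier \<Omega>" "infdist x (frontier \<Omega>) = dist x y"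
    using infdist_attains_inf[OF frontier_closed \<Omega>(2)] by metis
  have "onorm (\<lambda>h. grad \<phi> z \<bullet> h) \<le> L" for z
  proof (rule onorm_le)
    fix h
    have "norm (grad \<phi> z) \<le> L"
      using L Cc_infty_grad_zero_outside[OF \<phi>, of z] by (cases "z \<in> \<Omega>") auto
    then show "norm (grad \<phi> z \<bullet> h) \<le> L * norm h"
      by (metis Cauchy_Schwarz_ineq2 mult_right_mono norm_ge_zero order_trans real_norm_def)
  qed
  then have "norm (\<phi> x - \<phi> y) \<le> L * norm (x - y)"
    using has_derivative_grad[OF Cc_infty_differentiable[OF \<phi>]]
    by (intro differentiable_bound[of UNIV]) auto
  moreover have "\<phi> y = 0"
    using y \<Omega>(1) by (intro Cc_infty_zero_outside[OF \<phi>]) (auto simp: frontier_def interior_open)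
  ultimately show ?thesis
    using y by (simp add: dist_norm)
qed

lemma admissible_seq_grad_norm_nonneg:
  assumes "admissible_seq \<Omega> u us" "\<Omega> \<noteq> {}"
  shows "0 \<le> grad_norm \<Omega> u"
  using assms unfolding admissible_seq_def by (meson all_not_in_conv norm_ge_zero order_trans)

lemma admissible_seq_tendsto:
  assumes "admissible_seq \<Omega> u us" "x \<in> \<Omega>"
  shows "(\<lambda>k. us k x) \<longlonglongrightarrow> u x"
  using assms tendsto_uniform_limitI unfolding admissible_seq_def by metis

lemma admissible_seq_le_infdist:
  assumes "admissible_seq \<Omega> u us" "open \<Omega>" "\<Omega> \<noteq> {}" "frontier \<Omega> \<noteq> {}"
  shows "\<bar>us k x\<bar> \<le> grad_norm \<Omega> u * infdist x (frontier \<Omega>)"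
  using assms admissible_seq_grad_norm_nonneg[OF assms(1,3)]
  by (intro Cc_infty_le_infdist) (auto simp: admissible_seq_def)

text \<open>The gradient of \<open>u\<close> is bounded only almost everywhere, hence possibly not along a given
  segment. The smooth approximations have the bound everywhere and pass it on to \<open>u\<close>.\<close>

lemma admissible_limit_le_infdist:
  assumes "admissible_seq \<Omega> u us" "open \<Omega>" "\<Omega> \<noteq> {}" "frontier \<Omega> \<noteq> {}" "x \<in> \<Omega>"
  shows "\<bar>u x\<bar> \<le> grad_norm \<Omega> u * infdist x (frontier \<Omega>)"
  using admissible_seq_le_infdist[OF assms(1-4)]
  by (intro tendsto_upperbound[OF tendsto_rabs[OF admissible_seq_tendsto[OF assms(1,5)]]]) auto

section \<open>Maximum points of minimizers lie on the high ridge\<close>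

lemma Lip0_continuous_on: "u \<in> Lip0 \<Omega> \<Longrightarrow> continuous_on (closure \<Omega>) u"
  unfolding Lip0_def using lipschitz_on_continuous_on by blast

lemma bounded_closure_continuous:
  fixes u :: "'a::euclidean_space \<Rightarrow> real"
  assumes "bounded \<Omega>" "continuous_on (closure \<Omega>) u"
  obtains B where "\<And>x. x \<in> closure \<Omega> \<Longrightarrow> \<bar>u x\<bar> \<le> B"
proof -
  have "bounded (u ` closure \<Omega>)"
    using assms compact_closure compact_continuous_image compact_imp_bounded by blast
  then show ?thesis
    using that unfolding bounded_iff by auto
qed

lemma abs_le_sup_norm:
  fixes u :: "'a::euclidean_space \<Rightarrow> real"
  assumes "bounded \<Omega>" "continuous_on (closure \<Omega>) u" "x \<in> \<Omega>"
  shows "\<bar>u x\<bar> \<le> sup_norm \<Omega> u"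
proof -
  obtain B where "\<And>x. x \<in> closure \<Omega> \<Longrightarrow> \<bar>u x\<bar> \<le> B"
    using bounded_closure_continuous[OF assms(1,2)] by blast
  then have "bdd_above ((\<lambda>x. \<bar>u x\<bar>) ` \<Omega>)"
    using closure_subset by (intro bdd_aboveI2[of _ _ B]) blast
  then show ?thesis
    unfolding sup_norm_def using assms(3) by (intro cSUP_upper)
qed

lemma Lip0_nonzero_interior:
  assumes "u \<in> Lip0_nonzero \<Omega>" "open \<Omega>"
  obtains x where "x \<in> \<Omega>" "u x \<noteq> 0"
proof -
  obtain x where "x \<in> closure \<Omega>" "u x \<noteq> 0" "x \<notin> frontier \<Omega>"
    using assms unfolding Lip0_nonzero_def Lip0_def by auto
  then show ?thesis
    using that assms(2) by (auto simp: frontier_def interior_open)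
qed

lemma sup_norm_pos:
  assumes "u \<in> Lip0_nonzero \<Omega>" "open \<Omega>" "bounded \<Omega>"
  shows "0 < sup_norm \<Omega> u"
proof -
  obtain x where "x \<in> \<Omega>" "u x \<noteq> 0"
    using Lip0_nonzero_interior assms(1,2) by blast
  moreover have "continuous_on (closure \<Omega>) u"
    using assms(1) Lip0_continuous_on by (auto simp: Lip0_nonzero_def)
  ultimately show ?thesis
    using abs_le_sup_norm[OF assms(3), of u x] by linarith
qed

lemma grad_norm_pos:
  assumes "u \<in> Lip0_nonzero \<Omega>" "admissible_seq \<Omega> u us" "open \<Omega>" "\<Omega> \<noteq> {}" "frontier \<Omega> \<noteq> {}"
  shows "0 < grad_norm \<Omega> u"
proof -
  obtain x where "x \<in> \<Omega>" "u x \<noteq> 0"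
    using Lip0_nonzero_interior assms(1,3) by blast
  then show ?thesis
    using admissible_limit_le_infdist[OF assms(2-5), of x]
      admissible_seq_grad_norm_nonneg[OF assms(2,4)]
    by (cases "grad_norm \<Omega> u = 0") auto
qed

lemma minimizer_rayleigh_eq_lambda:
  assumes "minimizer_infty \<Omega> u"
  shows "rayleigh_infty \<Omega> u = lambda_infty \<Omega>"
proof -
  have "u \<in> Lip0_nonzero \<Omega>" "\<And>w. w \<in> Lip0_nonzero \<Omega> \<Longrightarrow> rayleigh_infty \<Omega> u \<le> rayleigh_infty \<Omega> w"
    using assms unfolding minimizer_infty_def is_arg_min_def by (auto simp: not_less)
  then show ?thesis
    unfolding lambda_infty_def by (intro cInf_eq_minimum[symmetric]) auto
qed

lemma infdist_lipschitz: "1-lipschitz_on X (\<lambda>x. infdist x A)"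
  by (intro lipschitz_onI) (auto simp: dist_real_def infdist_triangle_abs)

lemma infdist_frontier_Lip0_nonzero:
  fixes \<Omega> :: "'a::euclidean_space set"
  assumes "open \<Omega>" "\<Omega> \<noteq> {}" "frontier \<Omega> \<noteq> {}"
  shows "(\<lambda>x. infdist x (frontier \<Omega>)) \<in> Lip0_nonzero \<Omega>"
proof -
  obtain x where x: "x \<in> \<Omega>" using assms(2) by auto
  then have "x \<notin> frontier \<Omega>"
    using assms(1) by (auto simp: frontier_def interior_open)
  then have "infdist x (frontier \<Omega>) \<noteq> 0"
    using in_closed_iff_infdist_zero[OF frontier_closed assms(3)] by blast
  then show ?thesis
    unfolding Lip0_nonzero_def Lip0_def
    using x closure_subset infdist_lipschitz by fastforce
qed

lemma grad_norm_le_lipschitz: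
  fixes f :: "'a::euclidean_space \<Rightarrow> real"
  assumes "L-lipschitz_on UNIV f"
  shows "grad_norm \<Omega> f \<le> L"
proof -
  let ?g = "\<lambda>x. ereal (norm (grad f x))" and ?M = "lebesgue_on \<Omega>"
  have L: "0 \<le> L" using lipschitz_on_nonneg[OF assms] .
  show ?thesis
  proof (cases "?g \<in> borel_measurable ?M")
    case True
    then have "esssup ?M ?g \<le> ereal L"
      using norm_grad_le_lipschitz[OF assms] by (intro esssup_I) auto
    then show ?thesis
      unfolding grad_norm_def using L by (cases "esssup ?M ?g") auto
  next
    case False
    \<comment> \<open>The essential supremum is then \<open>\<infinity>\<close>, which \<open>real_of_ereal\<close> sends to 0.\<close>
    then show ?thesis
      unfolding grad_norm_def using L by (simp add: esssup_non_measurable top_ereal_def)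
  qed
qed

text \<open>Let \<open>d\<close> be the distance to the boundary. Minimality of \<open>u\<close> against \<open>d\<close> gives
  \<open>L u * d y \<le> M u\<close> for every \<open>y\<close> in \<open>\<Omega>\<close>, while at a maximum point \<open>x\<close> of \<open>u\<close> the bound
  \<open>admissible_limit_le_infdist\<close> gives \<open>M u \<le> L u * d x\<close>; hence \<open>d y \<le> d x\<close>.\<close>

lemma omega_max_subset_high_ridge:
  fixes \<Omega> :: "'a::euclidean_space set"
  assumes \<Omega>: "open \<Omega>" "\<Omega> \<noteq> {}" "frontier \<Omega> \<noteq> {}" "bounded \<Omega>"
    and u: "u \<in> Lip0_nonzero \<Omega>" "minimizer_infty \<Omega> u" "admissible_seq \<Omega> u us"
  shows "omega_max \<Omega> u \<subseteq> high_ridge \<Omega>"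
proof
  fix x assume "x \<in> omega_max \<Omega> u"
  then have x: "x \<in> \<Omega>" "\<bar>u x\<bar> = sup_norm \<Omega> u"
    by (auto simp: omega_max_def)
  let ?d = "\<lambda>x. infdist x (frontier \<Omega>)"
  have d: "?d \<in> Lip0_nonzero \<Omega>"
    using infdist_frontier_Lip0_nonzero \<Omega> by blast
  have Lu: "0 < grad_norm \<Omega> u" using grad_norm_pos[OF u(1,3) \<Omega>(1-3)] .
  have Mu: "0 < sup_norm \<Omega> u" using sup_norm_pos[OF u(1) \<Omega>(1,4)] .
  have Md: "0 < sup_norm \<Omega> ?d" using sup_norm_pos[OF d \<Omega>(1,4)] .
  have "rayleigh_infty \<Omega> u \<le> rayleigh_infty \<Omega> ?d"
    using u(2) d unfolding minimizer_infty_def is_arg_min_def by (meson not_less)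
  also have "\<dots> \<le> 1 / sup_norm \<Omega> ?d"
    unfolding rayleigh_infty_def
    using grad_norm_le_lipschitz[OF infdist_lipschitz] Md by (intro divide_right_mono) auto
  finally have *: "grad_norm \<Omega> u * sup_norm \<Omega> ?d \<le> sup_norm \<Omega> u"
    using Mu Md by (simp add: rayleigh_infty_def field_simps)
  have "?d y \<le> ?d x" if "y \<in> \<Omega>" for y
  proof -
    have "?d y \<le> sup_norm \<Omega> ?d"
      using abs_le_sup_norm[OF \<Omega>(4) lipschitz_on_continuous_on[OF infdist_lipschitz] that]
      by (metis abs_ge_self order_trans)
    then have "grad_norm \<Omega> u * ?d y \<le> grad_norm \<Omega> u * ?d x"
      using * Lu x admissible_limit_le_infdist[OF u(3) \<Omega>(1-3) x(1)]
      by (smt (verit) mult_left_mono)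
    then show ?thesis using Lu by simp
  qed
  then show "x \<in> high_ridge \<Omega>"
    using x(1) by (auto simp: high_ridge_def is_arg_max_def not_less)
qed

section \<open>Integration against measures given by a density\<close>

lemma pos_measures_space:
  assumes "\<mu> \<in> pos_measures \<Omega>"
  shows "space \<mu> = \<Omega>" "sets \<mu> = borel_sets_on \<Omega>" "finite_measure \<mu>"
  using assms sets_eq_imp_space_eq[of \<mu> "restrict_space borel \<Omega>"]
  by (auto simp: pos_measures_def space_restrict_space)

lemma pos_measures_borel_measurable_continuous:
  assumes "\<mu> \<in> pos_measures \<Omega>" "continuous_on \<Omega> f"
  shows "f \<in> borel_measurable \<mu>"
  using borel_measurable_continuous_on_restrict[OF assms(2)] pos_measures_space(2)[OF assms(1)]
    measurable_cong_sets[of \<mu> "restrict_space borel \<Omega>" borel borel] by auto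

text \<open>The supremum of \<open>\<integral>\<^sub>B f\<close> over \<open>B \<subseteq> A\<close> is attained at \<open>B = A \<inter> {f > 0}\<close>. The coercion
  \<open>ennreal\<close> in the density cuts off the negative part of \<open>f\<close>.\<close>

lemma jordan_pos_eq_density:
  fixes f :: "'a::euclidean_space \<Rightarrow> real"
  assumes sets: "sets \<mu> = borel_sets_on \<Omega>" and f: "integrable \<mu> f"
    and m: "\<And>A. A \<in> sets \<mu> \<Longrightarrow> m A = (LINT x:A|\<mu>. f x)"
  shows "jordan_pos \<Omega> m = density \<mu> (\<lambda>x. ennreal (f x))"
proof -
  let ?D = "density \<mu> (\<lambda>x. ennreal (f x))"
  have fm [measurable]: "f \<in> borel_measurable \<mu>" using f by simp
  have sp: "space \<mu> = \<Omega>"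
    using sets_eq_imp_space_eq[OF sets] by (simp add: space_restrict_space)
  have eq: "(SUP B\<in>{B \<in> borel_sets_on \<Omega>. B \<subseteq> A}. ennreal (m B)) = emeasure ?D A"
    if A: "A \<in> sets \<mu>" for A
  proof (rule antisym)
    show "(SUP B\<in>{B \<in> borel_sets_on \<Omega>. B \<subseteq> A}. ennreal (m B)) \<le> emeasure ?D A"
    proof (rule SUP_least)
      fix B assume "B \<in> {B \<in> borel_sets_on \<Omega>. B \<subseteq> A}"
      then have B: "B \<in> sets \<mu>" "B \<subseteq> A" using sets by auto
      have int: "integrable \<mu> (\<lambda>x. indicator A x * max 0 (f x))"
        using integrable_mult_indicator[OF A, of "\<lambda>x. max 0 (f x)"] f by simp
      have "m B \<le> (\<integral>x. indicator A x * max 0 (f x) \<partial>\<mu>)"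
        unfolding m[OF B(1)] set_lebesgue_integral_def
        using int f B integrable_mult_indicator[OF B(1) f]
        by (intro integral_mono) (auto split: split_indicator)
      then have "ennreal (m B) \<le> ennreal (\<integral>x. indicator A x * max 0 (f x) \<partial>\<mu>)"
        by (rule ennreal_leI)
      also have "\<dots> = (\<integral>\<^sup>+x. ennreal (indicator A x * max 0 (f x)) \<partial>\<mu>)"
        using int by (intro nn_integral_eq_integral[symmetric]) auto
      also have "\<dots> = emeasure ?D A"
        using A by (subst emeasure_density)
          (auto intro!: nn_integral_cong split: split_indicator simp: max_def ennreal_neg)
      finally show "ennreal (m B) \<le> emeasure ?D A" .
    qed
  next
    let ?B = "A \<inter> {x \<in> space \<mu>. 0 < f x}"
    have B: "?B \<in> sets \<mu>" using A by measurable
    have "emeasure ?D A = (\<integral>\<^sup>+x. ennreal (indicator ?B x *\<^sub>R f x) \<partial>\<mu>)"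
      using A by (subst emeasure_density)
        (auto intro!: nn_integral_cong split: split_indicator simp: ennreal_neg not_less)
    also have "\<dots> = ennreal (m ?B)"
      unfolding m[OF B] set_lebesgue_integral_def
      by (intro nn_integral_eq_integral integrable_mult_indicator B f) (auto split: split_indicator)
    also have "\<dots> \<le> (SUP B\<in>{B \<in> borel_sets_on \<Omega>. B \<subseteq> A}. ennreal (m B))"
      using B sets by (intro SUP_upper) auto
    finally show "emeasure ?D A \<le> (SUP B\<in>{B \<in> borel_sets_on \<Omega>. B \<subseteq> A}. ennreal (m B))" .
  qed
  have "jordan_pos \<Omega> m = measure_of (space ?D) (sets ?D) (emeasure ?D)"
    unfolding jordan_pos_def space_density sets_density sp sets
    using eq sets sp sets.sigma_sets_eq[of \<mu>] sets.space_closed[of \<mu>]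
    by (intro measure_of_eq) auto
  then show ?thesis
    by (simp only: measure_of_of_measure)
qed

lemma integrable_mult_bounded:
  fixes f \<phi> :: "'a \<Rightarrow> real"
  assumes "integrable \<mu> f" "\<phi> \<in> borel_measurable \<mu>" "\<And>x. x \<in> space \<mu> \<Longrightarrow> \<bar>\<phi> x\<bar> \<le> C"
  shows "integrable \<mu> (\<lambda>x. f x * \<phi> x)"
proof (rule Bochner_Integration.integrable_bound)
  show "integrable \<mu> (\<lambda>x. C * \<bar>f x\<bar>)" using assms(1) by simp
  show "(\<lambda>x. f x * \<phi> x) \<in> borel_measurable \<mu>" using assms(1,2) by simp
  show "AE x in \<mu>. norm (f x * \<phi> x) \<le> norm (C * \<bar>f x\<bar>)"
  proof (rule AE_I2)
    fix x assume "x \<in> space \<mu>"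
    then have "\<bar>\<phi> x\<bar> \<le> \<bar>C\<bar>" using assms(3)[of x] by linarith
    then show "norm (f x * \<phi> x) \<le> norm (C * \<bar>f x\<bar>)"
      by (simp add: abs_mult mult.commute mult_right_mono)
  qed
qed

lemma signed_integral_eq:
  fixes f \<phi> :: "'a::euclidean_space \<Rightarrow> real"
  assumes sets: "sets \<mu> = borel_sets_on \<Omega>" and f: "integrable \<mu> f"
    and m: "\<And>A. A \<in> sets \<mu> \<Longrightarrow> m A = (LINT x:A|\<mu>. f x)"
    and \<phi>: "\<phi> \<in> borel_measurable \<mu>" "\<And>x. x \<in> space \<mu> \<Longrightarrow> \<bar>\<phi> x\<bar> \<le> C"
  shows "signed_integral \<Omega> m \<phi> = (\<integral>x. f x * \<phi> x \<partial>\<mu>)"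
proof -
  have pos: "(\<integral>x. \<phi> x \<partial>density \<mu> (\<lambda>x. ennreal (g x))) = (\<integral>x. max 0 (g x) * \<phi> x \<partial>\<mu>)"
    if "integrable \<mu> g" for g
  proof -
    have "(\<lambda>x. ennreal (g x)) = (\<lambda>x. ennreal (max 0 (g x)))"
      by (auto simp: max_def ennreal_neg)
    then show ?thesis
      using that \<phi>(1) by (simp add: integral_density)
  qed
  have "jordan_pos \<Omega> m = density \<mu> (\<lambda>x. ennreal (f x))"
    by (intro jordan_pos_eq_density assms)
  moreover have "jordan_pos \<Omega> (\<lambda>A. - m A) = density \<mu> (\<lambda>x. ennreal (- f x))"
    using sets f m by (intro jordan_pos_eq_density) (auto simp: set_lebesgue_integral_def)
  ultimately have "signed_integral \<Omega> m \<phi>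
      = (\<integral>x. max 0 (f x) * \<phi> x \<partial>\<mu>) - (\<integral>x. max 0 (- f x) * \<phi> x \<partial>\<mu>)"
    unfolding signed_integral_def using pos[of f] pos[of "\<lambda>x. - f x"] f by simp
  also have "\<dots> = (\<integral>x. max 0 (f x) * \<phi> x - max 0 (- f x) * \<phi> x \<partial>\<mu>)"
    using f \<phi> by (intro Bochner_Integration.integral_diff[symmetric] integrable_mult_bounded) auto
  also have "\<dots> = (\<integral>x. f x * \<phi> x \<partial>\<mu>)"
    by (intro Bochner_Integration.integral_cong) (auto simp: max_def)
  finally show ?thesis .
qed

lemma vec_integral_weighted:
  fixes f F :: "'a::euclidean_space \<Rightarrow> 'a"
  assumes sets: "sets \<mu> = borel_sets_on \<Omega>" and f: "integrable \<mu> f"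
    and F: "F \<in> borel_measurable \<mu>" "\<And>x. x \<in> space \<mu> \<Longrightarrow> norm (F x) \<le> C"
  shows "vec_integral \<Omega> (weighted \<mu> f) F = (\<integral>x. f x \<bullet> F x \<partial>\<mu>)"
proof -
  have Fb: "\<bar>F x \<bullet> b\<bar> \<le> C" if "x \<in> space \<mu>" "b \<in> Basis" for x b
    using F(2)[OF that(1)] Basis_le_norm[OF that(2), of "F x"] by linarith
  have "signed_integral \<Omega> (\<lambda>A. weighted \<mu> f A \<bullet> b) (\<lambda>x. F x \<bullet> b)
      = (\<integral>x. (f x \<bullet> b) * (F x \<bullet> b) \<partial>\<mu>)" if b: "b \<in> Basis" for b
  proof (rule signed_integral_eq[OF sets _ _ _ Fb[OF _ b]])
    show "weighted \<mu> f A \<bullet> b = (LINT x:A|\<mu>. f x \<bullet> b)" if "A \<in> sets \<mu>" for A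
      unfolding weighted_def set_lebesgue_integral_def
      using integrable_mult_indicator[OF that f] by (simp flip: integral_inner_left)
  qed (use f F in auto)
  then have "vec_integral \<Omega> (weighted \<mu> f) F = (\<Sum>b\<in>Basis. (\<integral>x. (f x \<bullet> b) * (F x \<bullet> b) \<partial>\<mu>))"
    unfolding vec_integral_def by simp
  also have "\<dots> = (\<integral>x. (\<Sum>b\<in>Basis. (f x \<bullet> b) * (F x \<bullet> b)) \<partial>\<mu>)"
    using f F Fb
    by (intro Bochner_Integration.integral_sum[symmetric] integrable_mult_bounded) auto
  also have "\<dots> = (\<integral>x. f x \<bullet> F x \<partial>\<mu>)"
    by (simp flip: euclidean_inner)
  finally show ?thesis .
qed

section \<open>Tangential gradients\<close>

lemma Linf_integrable:
  assumes "finite_measure \<mu>" "f \<in> Linf \<mu>"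
  shows "integrable \<mu> f"
  using assms finite_measure.integrable_const_bound unfolding Linf_def by blast

lemma orth_proj_props:
  fixes S :: "'a::euclidean_space set"
  assumes "subspace S"
  shows "orth_proj S c \<in> S" "\<And>z. z \<in> S \<Longrightarrow> (c - orth_proj S c) \<bullet> z = 0"
proof -
  let ?P = "\<lambda>y. y \<in> S \<and> (\<forall>z\<in>S. orthogonal (c - y) z)"
  obtain y z where "y \<in> span S" "\<And>w. w \<in> span S \<Longrightarrow> orthogonal z w" "c = y + z"
    using orthogonal_subspace_decomp_exists by metis
  then have y: "?P y"
    using assms by (simp add: span_eq_iff[THEN iffD2])
  have uniq: "y' = y" if "?P y'" for y'
  proof -
    have "y - y' \<in> S" using y that assms by (simp add: subspace_diff)
    then have "(c - y') \<bullet> (y - y') = 0" "(c - y) \<bullet> (y - y') = 0"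
      using y that by (auto simp: orthogonal_def)
    then have "(y - y') \<bullet> (y - y') = 0"
      by (simp add: inner_diff_left)
    then show ?thesis by simp
  qed
  have "orth_proj S c = y"
    unfolding orth_proj_def by (rule the_equality[where P = ?P, OF y uniq])
  then have "?P (orth_proj S c)"
    using y by simp
  then show "orth_proj S c \<in> S" "\<And>z. z \<in> S \<Longrightarrow> (c - orth_proj S c) \<bullet> z = 0"
    by (auto simp: orthogonal_def)
qed

lemma norm_orth_proj_le:
  fixes S :: "'a::euclidean_space set"
  assumes "subspace S"
  shows "norm (orth_proj S c) \<le> norm c"
proof -
  let ?p = "orth_proj S c"
  have "?p \<bullet> ?p = c \<bullet> ?p"
    using orth_proj_props(2)[OF assms orth_proj_props(1)[OF assms]]
    by (simp add: inner_diff_left)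
  then have "norm ?p * norm ?p \<le> norm c * norm ?p"
    by (metis norm_cauchy_schwarz power2_eq_square power2_norm_eq_inner)
  then show ?thesis
    by (cases "?p = 0") auto
qed

text \<open>Testing with the direction of \<open>f\<close> on the set where \<open>\<bar>f\<bar> > c\<close> shows that this set is null.\<close>

lemma weak_star_limit_norm_le:
  fixes f :: "'a \<Rightarrow> 'b::euclidean_space"
  assumes fin: "finite_measure \<mu>" and lim: "weak_star_limit \<mu> fs f"
    and le: "\<And>k x. x \<in> space \<mu> \<Longrightarrow> norm (fs k x) \<le> c"
  shows "AE x in \<mu>. norm (f x) \<le> c"
proof -
  interpret finite_measure \<mu> by fact
  have fL: "f \<in> Linf \<mu>" "\<And>k. fs k \<in> Linf \<mu>" using lim by (auto simp: weak_star_limit_def)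
  then have fm [measurable]: "f \<in> borel_measurable \<mu>" "\<And>k. fs k \<in> borel_measurable \<mu>"
    by (auto simp: Linf_def)
  have fi: "integrable \<mu> (\<lambda>x. norm (f x))"
    using Linf_integrable[OF fin fL(1)] by simp
  define A where "A = {x \<in> space \<mu>. c < norm (f x)}"
  have A [measurable]: "A \<in> sets \<mu>" unfolding A_def by measurable
  define \<theta> where "\<theta> x = indicator A x *\<^sub>R sgn (f x)" for x
  have \<theta>m [measurable]: "\<theta> \<in> borel_measurable \<mu>" unfolding \<theta>_def sgn_div_norm by measurable
  have \<theta>1: "norm (\<theta> x) \<le> indicator A x" for x
    by (auto simp: \<theta>_def norm_sgn split: split_indicator)
  have \<theta>i: "integrable \<mu> \<theta>"
    by (rule integrable_const_bound[of _ 1]) (use \<theta>1 in \<open>auto intro!: AE_I2 order_trans[OF \<theta>1] split: split_indicator\<close>)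
  have conv: "(\<lambda>k. \<integral>x. \<theta> x \<bullet> fs k x \<partial>\<mu>) \<longlonglongrightarrow> (\<integral>x. \<theta> x \<bullet> f x \<partial>\<mu>)"
    using lim \<theta>i by (auto simp: weak_star_limit_def)
  have ci: "integrable \<mu> (\<lambda>x. indicator A x * c)" by (simp add: integrable_real_indicator emeasure_eq_measure)
  have "(\<integral>x. \<theta> x \<bullet> fs k x \<partial>\<mu>) \<le> (\<integral>x. indicator A x * c \<partial>\<mu>)" for k
  proof -
    have bd: "\<bar>\<theta> x \<bullet> fs k x\<bar> \<le> indicator A x * c" if "x \<in> space \<mu>" for x
    proof -
      have "\<bar>\<theta> x \<bullet> fs k x\<bar> \<le> norm (\<theta> x) * norm (fs k x)" by (rule Cauchy_Schwarz_ineq2)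
      also have "\<dots> \<le> indicator A x * c" using \<theta>1 le[OF that] by (intro mult_mono) auto
      finally show ?thesis .
    qed
    have "integrable \<mu> (\<lambda>x. \<theta> x \<bullet> fs k x)"
      by (rule Bochner_Integration.integrable_bound[OF ci]) (use bd in \<open>auto intro!: AE_I2 order_trans[OF bd]\<close>)
    then show ?thesis
      using ci bd by (intro integral_mono) (auto dest!: bd)
  qed
  then have "(\<integral>x. \<theta> x \<bullet> f x \<partial>\<mu>) \<le> (\<integral>x. indicator A x * c \<partial>\<mu>)"
    by (intro tendsto_upperbound[OF conv]) auto
  moreover have "\<theta> x \<bullet> f x = indicator A x * norm (f x)" for x
    by (cases "f x = 0")
      (simp_all add: \<theta>_def sgn_div_norm power2_norm_eq_inner[symmetric] power2_eq_square)
  ultimately have le0: "(\<integral>x. indicator A x * norm (f x) \<partial>\<mu>) \<le> (\<integral>x. indicator A x * c \<partial>\<mu>)"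
    by simp
  let ?h = "\<lambda>x. indicator A x * norm (f x) - indicator A x * c"
  have fAi: "integrable \<mu> (\<lambda>x. indicator A x * norm (f x))"
    using integrable_mult_indicator[OF A fi] by simp
  have hi: "integrable \<mu> ?h" using fAi ci by (rule Bochner_Integration.integrable_diff)
  have h0: "AE x in \<mu>. 0 \<le> ?h x" by (auto simp: A_def split: split_indicator)
  have "(\<integral>x. ?h x \<partial>\<mu>) \<le> 0" using le0 fAi ci by simp
  moreover have "0 \<le> (\<integral>x. ?h x \<partial>\<mu>)" using h0 by (rule integral_nonneg_AE)
  ultimately have "AE x in \<mu>. ?h x = 0"
    using integral_nonneg_eq_0_iff_AE[OF hi h0] by linarith
  then show ?thesis
    using AE_space
    by eventually_elim (rule ccontr, auto simp: A_def indicator_def)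
qed

lemma tangential_gradient_norm_le:
  assumes "\<tau> \<in> pos_measures \<Omega>" "tangent_space \<Omega> \<tau> T" "tangential_gradient \<Omega> \<tau> T u g"
  shows "AE x in \<tau>. norm (g x) \<le> grad_norm \<Omega> u"
proof -
  note sp = pos_measures_space[OF assms(1)]
  obtain us where us: "admissible_seq \<Omega> u us" "weak_star_limit \<tau> (\<lambda>k x. orth_proj (T x) (grad (us k) x)) g"
    using assms(3) unfolding tangential_gradient_def by blast
  show ?thesis
  proof (rule weak_star_limit_norm_le[OF sp(3) us(2)])
    fix k x assume "x \<in> space \<tau>"
    then have "subspace (T x)" "norm (grad (us k) x) \<le> grad_norm \<Omega> u"
      using assms(2) us(1) sp(1) by (auto simp: tangent_space_def admissible_seq_def)
    then show "norm (orth_proj (T x) (grad (us k) x)) \<le> grad_norm \<Omega> u"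
      using norm_orth_proj_le order_trans by blast
  qed
qed

text \<open>Tangency is by definition orthogonality to \<open>N_space\<close>. Each projected gradient is a tangent
  field, and the members of \<open>N_space\<close>, being bounded, are admissible test fields for the weak*
  convergence, so the orthogonality survives the limit.\<close>

lemma tangential_gradient_tangent:
  assumes "\<tau> \<in> pos_measures \<Omega>" "tangent_space \<Omega> \<tau> T" "tangential_gradient \<Omega> \<tau> T u g"
  shows "AE x in \<tau>. g x \<in> T x"
proof -
  note sp = pos_measures_space[OF assms(1)]
  obtain us where "weak_star_limit \<tau> (\<lambda>k x. orth_proj (T x) (grad (us k) x)) g"
    using assms(3) unfolding tangential_gradient_def by blast
  then have P: "\<And>k. (\<lambda>x. orth_proj (T x) (grad (us k) x)) \<in> Linf \<tau>" and g: "g \<in> Linf \<tau>"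
    and lim: "\<And>\<theta>. integrable \<tau> \<theta> \<Longrightarrow>
      (\<lambda>k. \<integral>x. \<theta> x \<bullet> orth_proj (T x) (grad (us k) x) \<partial>\<tau>) \<longlonglongrightarrow> (\<integral>x. \<theta> x \<bullet> g x \<partial>\<tau>)"
    by (auto simp: weak_star_limit_def)
  have tan: "(\<forall>\<xi>\<in>N_space \<Omega> \<tau>. (\<integral>x. \<theta> x \<bullet> \<xi> x \<partial>\<tau>) = 0) \<longleftrightarrow> (AE x in \<tau>. \<theta> x \<in> T x)"
    if "integrable \<tau> \<theta>" for \<theta>
    using assms(2) that by (auto simp: tangent_space_def)
  have "(\<integral>x. g x \<bullet> \<xi> x \<partial>\<tau>) = 0" if \<xi>: "\<xi> \<in> N_space \<Omega> \<tau>" for \<xi>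
  proof -
    have "(\<integral>x. orth_proj (T x) (grad (us k) x) \<bullet> \<xi> x \<partial>\<tau>) = 0" for k
    proof -
      have "AE x in \<tau>. orth_proj (T x) (grad (us k) x) \<in> T x"
        using assms(2) sp(1) orth_proj_props(1) by (intro AE_I2) (auto simp: tangent_space_def)
      then show ?thesis
        using tan[OF Linf_integrable[OF sp(3) P]] \<xi> by blast
    qed
    moreover have "integrable \<tau> \<xi>"
      using \<xi> Linf_integrable[OF sp(3)] by (auto simp: N_space_def)
    ultimately show ?thesis
      using lim[of \<xi>] by (simp add: inner_commute LIMSEQ_const_iff)
  qed
  then show ?thesis
    using tan[OF Linf_integrable[OF sp(3) g]] by blast
qed

section \<open>Testing the optimality condition with another minimizer\<close>

lemma has_divergence_weighted_test:
  fixes \<Omega> :: "'a::euclidean_space set"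
  assumes div: "has_divergence \<Omega> (weighted \<tau> g) (\<lambda>A. - (c * weighted \<nu> w A))"
    and \<tau>: "\<tau> \<in> pos_measures \<Omega>" and \<nu>: "\<nu> \<in> pos_measures \<Omega>"
    and int: "integrable \<tau> g" "integrable \<nu> w"
    and \<phi>: "\<phi> \<in> Cc_infty \<Omega>" "\<And>x. x \<in> \<Omega> \<Longrightarrow> \<bar>\<phi> x\<bar> \<le> B" "\<And>x. x \<in> \<Omega> \<Longrightarrow> norm (grad \<phi> x) \<le> C"
  shows "(\<integral>x. g x \<bullet> grad \<phi> x \<partial>\<tau>) = c * (\<integral>x. w x * \<phi> x \<partial>\<nu>)"
proof -
  note sp = pos_measures_space[OF \<tau>] pos_measures_space[OF \<nu>]
  have m: "grad \<phi> \<in> borel_measurable \<tau>" "\<phi> \<in> borel_measurable \<nu>"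
    using pos_measures_borel_measurable_continuous \<tau> \<nu> continuous_on_subset
      Cc_infty_grad_continuous[OF \<phi>(1)] Cc_infty_continuous[OF \<phi>(1)]
    by (metis subset_UNIV)+
  have "- vec_integral \<Omega> (weighted \<tau> g) (grad \<phi>) = signed_integral \<Omega> (\<lambda>A. - (c * weighted \<nu> w A)) \<phi>"
    using div \<phi>(1) by (auto simp: has_divergence_def)
  moreover have "vec_integral \<Omega> (weighted \<tau> g) (grad \<phi>) = (\<integral>x. g x \<bullet> grad \<phi> x \<partial>\<tau>)"
    using \<phi>(3) sp m int by (intro vec_integral_weighted[where C = C]) auto
  moreover have "signed_integral \<Omega> (\<lambda>A. - (c * weighted \<nu> w A)) \<phi> = (\<integral>x. (- c * w x) * \<phi> x \<partial>\<nu>)"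
    using \<phi>(2) sp m int
    by (intro signed_integral_eq[where C = B])
      (auto simp: weighted_def set_lebesgue_integral_def mult.left_commute)
  moreover have "(\<integral>x. (- c * w x) * \<phi> x \<partial>\<nu>) = - (c * (\<integral>x. w x * \<phi> x \<partial>\<nu>))"
    by (simp add: mult.assoc)
  ultimately show ?thesis by simp
qed

text \<open>Take the previous identity for an admissible sequence of \<open>v\<close>. Since \<open>gu\<close> is tangent, the
  gradients on the left may be replaced by their projections, which converge weakly* to \<open>gv\<close> and
  may be tested with the bounded field \<open>gu\<close>; on the right, the sequence is uniformly bounded and
  dominated convergence applies.\<close>

lemma tangential_gradients_inner_integral:
  fixes \<Omega> :: "'a::euclidean_space set"
  assumes \<Omega>: "open \<Omega>" "\<Omega> \<noteq> {}" "frontier \<Omega> \<noteq> {}" "bounded \<Omega>"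
    and div: "has_divergence \<Omega> (weighted \<tau> gu) (\<lambda>A. - (c * weighted \<nu> w A))"
    and \<tau>: "\<tau> \<in> pos_measures \<Omega>" and \<nu>: "\<nu> \<in> pos_measures \<Omega>" and w: "integrable \<nu> w"
    and T: "tangent_space \<Omega> \<tau> T"
    and gu: "tangential_gradient \<Omega> \<tau> T u gu" and gv: "tangential_gradient \<Omega> \<tau> T v gv"
    and v: "v \<in> borel_measurable \<nu>"
  shows "(\<integral>x. gu x \<bullet> gv x \<partial>\<tau>) = c * (\<integral>x. w x * v x \<partial>\<nu>)"
proof -
  note sp = pos_measures_space[OF \<tau>] pos_measures_space[OF \<nu>]
  obtain vs where vs: "admissible_seq \<Omega> v vs"
    and lim: "weak_star_limit \<tau> (\<lambda>k x. orth_proj (T x) (grad (vs k) x)) gv"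
    using gv unfolding tangential_gradient_def by blast
  have "gu \<in> Linf \<tau>"
    using gu unfolding tangential_gradient_def weak_star_limit_def by blast
  then have gui: "integrable \<tau> gu"
    using Linf_integrable sp(3) by blast
  let ?L = "grad_norm \<Omega> v"
  have L0: "0 \<le> ?L" using admissible_seq_grad_norm_nonneg[OF vs \<Omega>(2)] .
  obtain R where R: "\<And>x. x \<in> closure \<Omega> \<Longrightarrow> \<bar>infdist x (frontier \<Omega>)\<bar> \<le> R"
    using bounded_closure_continuous[OF \<Omega>(4) lipschitz_on_continuous_on[OF infdist_lipschitz]] by blast
  have bd: "\<bar>vs k x\<bar> \<le> ?L * R" if "x \<in> \<Omega>" for k x
  proof -
    have "infdist x (frontier \<Omega>) \<le> R" using R[of x] that closure_subset by fastforce
    then have "?L * infdist x (frontier \<Omega>) \<le> ?L * R" using L0 by (rule mult_left_mono)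
    then show ?thesis using admissible_seq_le_infdist[OF vs \<Omega>(1-3), of k x] by linarith
  qed
  have vsC: "vs k \<in> Cc_infty \<Omega>" for k using vs by (auto simp: admissible_seq_def)
  have vsm: "vs k \<in> borel_measurable \<nu>" "grad (vs k) \<in> borel_measurable \<tau>" for k
    using pos_measures_borel_measurable_continuous \<tau> \<nu> continuous_on_subset
      Cc_infty_grad_continuous[OF vsC] Cc_infty_continuous[OF vsC]
    by (metis subset_UNIV)+
  have "(\<integral>x. gu x \<bullet> orth_proj (T x) (grad (vs k) x) \<partial>\<tau>) = c * (\<integral>x. w x * vs k x \<partial>\<nu>)" for k
  proof -
    have Pm: "(\<lambda>x. orth_proj (T x) (grad (vs k) x)) \<in> borel_measurable \<tau>"
      using lim by (auto simp: weak_star_limit_def Linf_def)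
    have "AE x in \<tau>. gu x \<bullet> orth_proj (T x) (grad (vs k) x) = gu x \<bullet> grad (vs k) x"
      using tangential_gradient_tangent[OF \<tau> T gu] AE_space
    proof eventually_elim
      case (elim x)
      then have "subspace (T x)" using T sp(1) by (auto simp: tangent_space_def)
      then have "(grad (vs k) x - orth_proj (T x) (grad (vs k) x)) \<bullet> gu x = 0"
        using elim orth_proj_props(2) by blast
      then have "gu x \<bullet> (grad (vs k) x - orth_proj (T x) (grad (vs k) x)) = 0"
        by (simp only: inner_commute)
      then show ?case by (simp add: inner_diff_right)
    qed
    then have "(\<integral>x. gu x \<bullet> orth_proj (T x) (grad (vs k) x) \<partial>\<tau>) = (\<integral>x. gu x \<bullet> grad (vs k) x \<partial>\<tau>)"
      using gui Pm vsm by (intro integral_cong_AE) auto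
    also have "\<dots> = c * (\<integral>x. w x * vs k x \<partial>\<nu>)"
      using bd vs by (intro has_divergence_weighted_test[OF div \<tau> \<nu> gui w vsC])
        (auto simp: admissible_seq_def)
    finally show ?thesis .
  qed
  moreover have "(\<lambda>k. \<integral>x. gu x \<bullet> orth_proj (T x) (grad (vs k) x) \<partial>\<tau>)
      \<longlonglongrightarrow> (\<integral>x. gu x \<bullet> gv x \<partial>\<tau>)"
    using lim gui by (auto simp: weak_star_limit_def)
  ultimately have "(\<lambda>k. c * (\<integral>x. w x * vs k x \<partial>\<nu>)) \<longlonglongrightarrow> (\<integral>x. gu x \<bullet> gv x \<partial>\<tau>)"
    by simp
  moreover have "(\<lambda>k. c * (\<integral>x. w x * vs k x \<partial>\<nu>)) \<longlonglongrightarrow> c * (\<integral>x. w x * v x \<partial>\<nu>)"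
  proof (intro tendsto_mult_left integral_dominated_convergence[where w = "\<lambda>x. \<bar>w x\<bar> * (?L * R)"])
    show "AE x in \<nu>. (\<lambda>k. w x * vs k x) \<longlonglongrightarrow> w x * v x"
      using admissible_seq_tendsto[OF vs] sp by (intro AE_I2 tendsto_mult_left) auto
    show "AE x in \<nu>. norm (w x * vs k x) \<le> \<bar>w x\<bar> * (?L * R)" for k
      using bd sp by (intro AE_I2) (auto simp: abs_mult intro!: mult_left_mono)
  qed (use w v vsm in auto)
  ultimately show ?thesis
    using LIMSEQ_unique by blast
qed

theorem proposition3p2:
  fixes \<Omega> :: "'a::euclidean_space set"
    and u v :: "'a \<Rightarrow> real"
    and \<nu> \<tau> :: "'a measure"
    and us :: "nat \<Rightarrow> 'a \<Rightarrow> real"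
    and T :: "'a \<Rightarrow> 'a set"
    and gu gv :: "'a \<Rightarrow> 'a"
    and \<sigma> :: "'a set \<Rightarrow> 'a"
  assumes "domain_on \<Omega>" and "bounded \<Omega>"
    and "u \<in> Lip0_nonzero \<Omega>" and "v \<in> Lip0_nonzero \<Omega>"
    and "\<forall>x\<in>closure \<Omega>. 0 \<le> u x" and "\<forall>x\<in>closure \<Omega>. 0 \<le> v x"
    and "minimizer_infty \<Omega> u" and "minimizer_infty \<Omega> v"
    and "omega_max \<Omega> v = high_ridge \<Omega>"
    and "\<nu> \<in> pos_measures \<Omega>" and "\<tau> \<in> pos_measures \<Omega>"
    and "tangent_space \<Omega> \<tau> T"
    and "tangential_gradient \<Omega> \<tau> T u gu" and "tangential_gradient \<Omega> \<tau> T v gv"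
    and "\<sigma> = weighted \<tau> gu"
    and "has_divergence \<Omega> \<sigma> (\<lambda>A. - (lambda_infty \<Omega> * weighted \<nu> u A))"
    and "measure \<nu> \<Omega> = 1 / sup_norm \<Omega> u"
    and "measure \<tau> \<Omega> = 1 / grad_norm \<Omega> u"
    and "measure \<nu> (\<Omega> - omega_max \<Omega> u) = 0"
    and "admissible_seq \<Omega> u us"
    and "measure \<tau> (\<Omega> - Omega_max \<Omega> u us) = 0"
    and "has_pairing \<Omega> u \<sigma> (\<lambda>A. grad_norm \<Omega> u * total_variation \<Omega> \<sigma> A)"
  shows "AE x in \<tau>. gu x \<bullet> gv x = norm (gu x) * norm (gv x)"
proof -
  have op: "open \<Omega>" and ne: "\<Omega> \<noteq> {}" using assms(1) by (auto simp: domain_on_def)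
  have "\<Omega> \<noteq> UNIV" using assms(2) not_bounded_UNIV by blast
  then have fr: "frontier \<Omega> \<noteq> {}" using ne frontier_not_empty by blast
  note \<Omega> = op ne fr assms(2)
  note \<tau> = assms(11) and \<nu> = assms(10)
  note sp = pos_measures_space[OF \<tau>] pos_measures_space[OF \<nu>]
  interpret \<tau>: finite_measure \<tau> by (rule sp)
  interpret \<nu>: finite_measure \<nu> by (rule sp)
  obtain vs where vs: "admissible_seq \<Omega> v vs"
    using assms(14) unfolding tangential_gradient_def by blast
  define Lu Lv Mu Mv where "Lu = grad_norm \<Omega> u" and "Lv = grad_norm \<Omega> v"
    and "Mu = sup_norm \<Omega> u" and "Mv = sup_norm \<Omega> v"
  have Lu: "0 < Lu" unfolding Lu_def using grad_norm_pos[OF assms(3) assms(20) \<Omega>(1-3)] .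
  have Lv: "0 < Lv" unfolding Lv_def using grad_norm_pos[OF assms(4) vs \<Omega>(1-3)] .
  have Mu: "0 < Mu" and Mv: "0 < Mv"
    unfolding Mu_def Mv_def using sup_norm_pos op assms(2,3,4) by auto
  have \<lambda>: "lambda_infty \<Omega> = Lv / Mv"
    using minimizer_rayleigh_eq_lambda[OF assms(8)]
    by (simp add: rayleigh_infty_def Lv_def Mv_def)

  have cu: "continuous_on (closure \<Omega>) u" and cv: "continuous_on (closure \<Omega>) v"
    using assms(3,4) Lip0_continuous_on by (auto simp: Lip0_nonzero_def)
  have um [measurable]: "u \<in> borel_measurable \<nu>" and vm [measurable]: "v \<in> borel_measurable \<nu>"
    using pos_measures_borel_measurable_continuous[OF \<nu>] continuous_on_subset cu cv closure_subset
    by blast+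
  have ui: "integrable \<nu> u"
    using abs_le_sup_norm[OF assms(2) cu] sp
    by (intro \<nu>.integrable_const_bound[of _ Mu]) (auto simp: Mu_def)

  have "AE x in \<nu>. u x * v x = Mu * Mv"
  proof -
    have "{x \<in> space \<nu>. \<bar>u x\<bar> = Mu} \<in> sets \<nu>" by measurable
    moreover have "omega_max \<Omega> u = {x \<in> space \<nu>. \<bar>u x\<bar> = Mu}"
      by (auto simp: omega_max_def Mu_def sp)
    ultimately have "\<Omega> - omega_max \<Omega> u \<in> null_sets \<nu>"
      using assms(19) sets.compl_sets[of "omega_max \<Omega> u" \<nu>] sp(4)
      by (auto simp: null_sets_def \<nu>.emeasure_eq_measure)
    then have "AE x in \<nu>. x \<notin> \<Omega> - omega_max \<Omega> u" by (rule AE_not_in)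
    then show ?thesis
      using AE_space
    proof eventually_elim
      case (elim x)
      then have xu: "x \<in> omega_max \<Omega> u" and x: "x \<in> closure \<Omega>"
        using sp(4) closure_subset by auto
      then have xv: "x \<in> omega_max \<Omega> v"
        using omega_max_subset_high_ridge[OF \<Omega> assms(3,7,20)] assms(9) by blast
      have "u x = Mu" "v x = Mv"
        using xu xv x assms(5,6) by (auto simp: omega_max_def Mu_def Mv_def)
      then show ?case by simp
    qed
  qed
  then have "(\<integral>x. u x * v x \<partial>\<nu>) = (\<integral>x. Mu * Mv \<partial>\<nu>)"
    by (intro integral_cong_AE) auto
  also have "\<dots> = Mv"
    using assms(17) Mu sp by (simp add: Mu_def)
  finally have uv: "(\<integral>x. u x * v x \<partial>\<nu>) = Mv" .
  have int: "(\<integral>x. gu x \<bullet> gv x \<partial>\<tau>) = Lv"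
    using tangential_gradients_inner_integral[OF \<Omega> assms(16)[unfolded assms(15)] \<tau> \<nu> ui
        assms(12-14) vm] uv \<lambda> Mv by simp

  have "gu \<in> borel_measurable \<tau>" "gv \<in> borel_measurable \<tau>"
    using assms(13,14) unfolding tangential_gradient_def weak_star_limit_def Linf_def by blast+
  then have m [measurable]: "(\<lambda>x. gu x \<bullet> gv x) \<in> borel_measurable \<tau>" by simp
  have bounds: "AE x in \<tau>. norm (gu x) \<le> Lu \<and> norm (gv x) \<le> Lv"
    using tangential_gradient_norm_le[OF \<tau> assms(12,13)]
      tangential_gradient_norm_le[OF \<tau> assms(12,14)] by (auto simp: Lu_def Lv_def)
  have prod: "norm (gu x) * norm (gv x) \<le> Lu * Lv" if "norm (gu x) \<le> Lu" "norm (gv x) \<le> Lv" for x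
    using that Lu by (intro mult_mono) auto
  have le: "AE x in \<tau>. \<bar>gu x \<bullet> gv x\<bar> \<le> Lu * Lv"
    using bounds by eventually_elim (meson Cauchy_Schwarz_ineq2 order_trans prod)
  have gi: "integrable \<tau> (\<lambda>x. gu x \<bullet> gv x)"
    using le by (intro \<tau>.integrable_const_bound[of _ "Lu * Lv"]) auto
  have nonneg: "AE x in \<tau>. 0 \<le> Lu * Lv - gu x \<bullet> gv x"
    using le by eventually_elim linarith
  have "(\<integral>x. Lu * Lv - gu x \<bullet> gv x \<partial>\<tau>) = 0"
    using gi int assms(18) Lu sp by (simp add: Lu_def)
  then have "AE x in \<tau>. Lu * Lv - gu x \<bullet> gv x = 0"
    using integral_nonneg_eq_0_iff_AE[OF _ nonneg] gi by simp
  then show ?thesis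
    using bounds
  proof eventually_elim
    case (elim x)
    then show ?case
      using prod[of x] norm_cauchy_schwarz[of "gu x" "gv x"] by linarith
  qed
qed

end
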